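(* Isomorphism classes of factorization brackets on a preorder $\mathcal{A}$ are in bijection with factorization systems on $\mathcal{A}$. Similarly, isomorphism classes of factorization bracket pairs on a preorder $\mathcal{A}$ are in bijection with model structures on $\mathcal{A}$.
   Context: A preorder (a set with a reflexive transitive relation $\leq$) is regarded as a small category with exactly one morphism $X\to Y$ if $X\leq Y$ and none otherwise; $X\cong Y$ means $X\leq Y\leq X$. Let $\mathrm{Rels}(\mathcal{A})$ be the set of ordered pairs $(X,Y)$ of objects of $\mathcal{A}$ with $X\leq Y$. A factorization bracket on $\mathcal{A}$ is a function $\Phi:\mathrm{Rels}(\mathcal{A})\to\mathcal{A}$ such that (whenever the pairs to which $\Phi$ is applied in the hypotheses are in $\mathrm{Rels}(\mathcal{A})$): (a) $X\leq \Phi(X,Y)\leq Y$; (b) if $X\leq Y$ and $\Phi(X,Y)\leq Z$, then $\Phi(\Phi(X,Y),Z)\cong \Phi(X,Z)$; (c) if $Y\leq Z$ and $X\leq \Phi(Y,Z)$, then $\Phi(X,\Phi(Y,Z))\cong \Phi(X,Z)$; (d) if $W\leq \Phi(Y,Z)$ and $\Phi(W,X)\leq Z$, then $\Phi(W,X)\leq \Phi(Y,Z)$. A factorization bracket pair on $\mathcal{A}$ is an ordered pair $(\Phi,\Psi)$ of factorization brackets on $\mathcal{A}$ such that: (e) if $X\leq Y$, then $\Psi(X,\Phi(X,Y))\cong \Phi(X,Y)$; (f) if $X\leq Y$, then $\Phi(\Psi(X,Y),Y)\cong \Psi(X,Y)$; (g) if $X\leq Y\leq Z$, then $\Phi(\Psi(X,Y),\Phi(Y,Z))\cong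 \Psi(\Psi(X,Y),\Phi(Y,Z))$; (h) if $X\leq Y\leq Z$ and $\Phi(\Psi(X,Y),\Psi(Y,Z))\cong \Psi(\Psi(X,Y),\Psi(Y,Z))$, then $\Phi(Y,\Psi(Y,Z))\cong \Psi(Y,Z)$; (i) if $X\leq Y\leq Z$ and $\Phi(\Phi(X,Y),\Phi(Y,Z))\cong \Psi(\Phi(X,Y),\Phi(Y,Z))$, then $\Psi(\Phi(X,Y),Y)\cong \Phi(X,Y)$. Two brackets $\Phi,\Phi'$ are isomorphic if $\Phi(X,Y)\cong\Phi'(X,Y)$ for all $X\leq Y$; two bracket pairs are isomorphic if they are so componentwise. A factorization system (weak and orthogonal factorization systems coincide on preorders) is a pair $(\mathcal{L},\mathcal{R})$ of classes of morphisms such that every morphism factors as a map in $\mathcal{L}$ followed by a map in $\mathcal{R}$, $\mathcal{L}$ is the class of maps with the left lifting property with respect to $\mathcal{R}$, and $\mathcal{R}$ is the class of maps with the right lifting property with respect to $\mathcal{L}$. A model structure is a triple $(\mathrm{cof},\mathrm{we},\mathrm{fib})$ of retract-closed subcategories containing all objects such that $(\mathrm{cof}\cap \mathrm{we},\mathrm{fib})$ and $(\mathrm{cof},\mathrm{we}\cap \mathrm{fib})$ are factorization systems and $\mathrm{we}$ has the two-out-of-three property; no limits or colimits in $\mathcal{A}$ are assumed. The intended bijections: a factorization system $(\mathcal{L},\mathcal{R})$ corresponds to the bracket $\Phi$ with $X\to\Phi(X,Y)$ in $\mathcal{L}$ and $\Phi(X,Y)\to Y$ in $\mathcal{R}$;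 a model structure corresponds to the pair $(\Phi,\Psi)$ of brackets of $(\mathrm{cof}\cap \mathrm{we},\mathrm{fib})$ and $(\mathrm{cof},\mathrm{we}\cap \mathrm{fib})$ respectively. *)

theory Defs
  imports Main "HOL-Library.FuncSet"
begin

text \<open>
  A preorder is a carrier \<open>A\<close> with a relation \<open>r\<close> such that \<^const>\<open>preorder_on\<close> holds;
  in particular \<open>r \<subseteq> A \<times> A\<close>, so \<open>r\<close> itself is the set of ordered pairs \<open>(X, Y)\<close> of objects
  with \<open>X \<le> Y\<close>, and also the set of morphisms of the associated category.
  All diagrams in this category commute, so lifting properties, compositions and retracts
  are expressed by the existence of the arrows alone.
\<close>

definition iso_in :: "'a rel \<Rightarrow> 'a \<Rightarrow> 'a \<Rightarrow> bool" where
  "iso_in r X Y \<longleftrightarrow> (X, Y) \<in> r \<and> (Y, X) \<in> r"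

subsection \<open>Factorization brackets\<close>

text \<open>
  A function defined on \<open>r\<close> only is represented by its extensional version in \<open>r \<rightarrow>\<^sub>E A\<close>.
\<close>

definition factorization_bracket :: "'a set \<Rightarrow> 'a rel \<Rightarrow> ('a \<times> 'a \<Rightarrow> 'a) \<Rightarrow> bool" where
  "factorization_bracket A r \<Phi> \<longleftrightarrow>
     \<Phi> \<in> r \<rightarrow>\<^sub>E A \<and>
     (\<forall>X Y. (X, Y) \<in> r \<longrightarrow> (X, \<Phi> (X, Y)) \<in> r \<and> (\<Phi> (X, Y), Y) \<in> r) \<and>
     (\<forall>X Y Z. (X, Y) \<in> r \<longrightarrow> (\<Phi> (X, Y), Z) \<in> r \<longrightarrow>
        iso_in r (\<Phi> (\<Phi> (X, Y), Z)) (\<Phi> (X, Z))) \<and>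
     (\<forall>X Y Z. (Y, Z) \<in> r \<longrightarrow> (X, \<Phi> (Y, Z)) \<in> r \<longrightarrow>
        iso_in r (\<Phi> (X, \<Phi> (Y, Z))) (\<Phi> (X, Z))) \<and>
     (\<forall>W X Y Z. (W, X) \<in> r \<longrightarrow> (Y, Z) \<in> r \<longrightarrow>
        (W, \<Phi> (Y, Z)) \<in> r \<longrightarrow> (\<Phi> (W, X), Z) \<in> r \<longrightarrow> (\<Phi> (W, X), \<Phi> (Y, Z)) \<in> r)"

definition factorization_bracket_pair ::
    "'a set \<Rightarrow> 'a rel \<Rightarrow> ('a \<times> 'a \<Rightarrow> 'a) \<Rightarrow> ('a \<times> 'a \<Rightarrow> 'a) \<Rightarrow> bool" where
  "factorization_bracket_pair A r \<Phi> \<Psi> \<longleftrightarrow>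
     factorization_bracket A r \<Phi> \<and> factorization_bracket A r \<Psi> \<and>
     (\<forall>X Y. (X, Y) \<in> r \<longrightarrow> iso_in r (\<Psi> (X, \<Phi> (X, Y))) (\<Phi> (X, Y))) \<and>
     (\<forall>X Y. (X, Y) \<in> r \<longrightarrow> iso_in r (\<Phi> (\<Psi> (X, Y), Y)) (\<Psi> (X, Y))) \<and>
     (\<forall>X Y Z. (X, Y) \<in> r \<longrightarrow> (Y, Z) \<in> r \<longrightarrow>
        iso_in r (\<Phi> (\<Psi> (X, Y), \<Phi> (Y, Z))) (\<Psi> (\<Psi> (X, Y), \<Phi> (Y, Z)))) \<and>
     (\<forall>X Y Z. (X, Y) \<in> r \<longrightarrow> (Y, Z) \<in> r \<longrightarrow>
        iso_in r (\<Phi> (\<Psi> (X, Y), \<Psi> (Y, Z))) (\<Psi> (\<Psi> (X, Y), \<Psi> (Y, Z))) \<longrightarrow>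
        iso_in r (\<Phi> (Y, \<Psi> (Y, Z))) (\<Psi> (Y, Z))) \<and>
     (\<forall>X Y Z. (X, Y) \<in> r \<longrightarrow> (Y, Z) \<in> r \<longrightarrow>
        iso_in r (\<Phi> (\<Phi> (X, Y), \<Phi> (Y, Z))) (\<Psi> (\<Phi> (X, Y), \<Phi> (Y, Z))) \<longrightarrow>
        iso_in r (\<Psi> (\<Phi> (X, Y), Y)) (\<Phi> (X, Y)))"

definition brackets :: "'a set \<Rightarrow> 'a rel \<Rightarrow> ('a \<times> 'a \<Rightarrow> 'a) set" where
  "brackets A r = {\<Phi>. factorization_bracket A r \<Phi>}"

definition bracket_pairs ::
    "'a set \<Rightarrow> 'a rel \<Rightarrow> (('a \<times> 'a \<Rightarrow> 'a) \<times> ('a \<times> 'a \<Rightarrow> 'a)) set" where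
  "bracket_pairs A r = {(\<Phi>, \<Psi>). factorization_bracket_pair A r \<Phi> \<Psi>}"

definition isomorphic_brackets ::
    "'a rel \<Rightarrow> ('a \<times> 'a \<Rightarrow> 'a) \<Rightarrow> ('a \<times> 'a \<Rightarrow> 'a) \<Rightarrow> bool" where
  "isomorphic_brackets r \<Phi> \<Phi>' \<longleftrightarrow> (\<forall>X Y. (X, Y) \<in> r \<longrightarrow> iso_in r (\<Phi> (X, Y)) (\<Phi>' (X, Y)))"

definition bracket_iso :: "'a set \<Rightarrow> 'a rel \<Rightarrow> ('a \<times> 'a \<Rightarrow> 'a) rel" where
  "bracket_iso A r =
     {(\<Phi>, \<Phi>'). \<Phi> \<in> brackets A r \<and> \<Phi>' \<in> brackets A r \<and> isomorphic_brackets r \<Phi> \<Phi>'}"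

definition bracket_pair_iso ::
    "'a set \<Rightarrow> 'a rel \<Rightarrow> (('a \<times> 'a \<Rightarrow> 'a) \<times> ('a \<times> 'a \<Rightarrow> 'a)) rel" where
  "bracket_pair_iso A r =
     {((\<Phi>, \<Psi>), (\<Phi>', \<Psi>')).
        (\<Phi>, \<Psi>) \<in> bracket_pairs A r \<and> (\<Phi>', \<Psi>') \<in> bracket_pairs A r \<and>
        isomorphic_brackets r \<Phi> \<Phi>' \<and> isomorphic_brackets r \<Psi> \<Psi>'}"

lemma iso_in_trans: "trans r \<Longrightarrow> iso_in r X Y \<Longrightarrow> iso_in r Y Z \<Longrightarrow> iso_in r X Z"
  unfolding iso_in_def by (meson transD)

lemma isomorphic_brackets_trans:
  "trans r \<Longrightarrow> isomorphic_brackets r P Q \<Longrightarrow> isomorphic_brackets r Q S \<Longrightarrow> isomorphic_brackets r P S"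
  unfolding isomorphic_brackets_def by (meson iso_in_trans)

lemma isomorphic_brackets_sym: "isomorphic_brackets r P Q \<Longrightarrow> isomorphic_brackets r Q P"
  unfolding isomorphic_brackets_def iso_in_def by blast

lemma isomorphic_brackets_refl:
  "preorder_on A r \<Longrightarrow> factorization_bracket A r P \<Longrightarrow> isomorphic_brackets r P P"
  unfolding isomorphic_brackets_def iso_in_def factorization_bracket_def preorder_on_def
  by (meson PiE_mem refl_onD)

lemma equiv_bracket_iso:
  assumes "preorder_on A r"
  shows "equiv (brackets A r) (bracket_iso A r)"
proof (rule equivI)
  show "bracket_iso A r \<subseteq> brackets A r \<times> brackets A r" 
    by (auto simp: bracket_iso_def)
  show "refl_on (brackets A r) (bracket_iso A r)"
    using assms by (auto simp: refl_on_def bracket_iso_def brackets_def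
        intro: isomorphic_brackets_refl)
  show "sym (bracket_iso A r)"
    by (auto simp: sym_def bracket_iso_def intro: isomorphic_brackets_sym)
  show "trans (bracket_iso A r)"
    using assms unfolding preorder_on_def
    by (intro transI) (auto simp: bracket_iso_def intro: isomorphic_brackets_trans)
qed

lemma equiv_bracket_pair_iso:
  assumes "preorder_on A r"
  shows "equiv (bracket_pairs A r) (bracket_pair_iso A r)"
proof (rule equivI)
  show "bracket_pair_iso A r \<subseteq> bracket_pairs A r \<times> bracket_pairs A r" 
    by (auto simp: bracket_pair_iso_def)
  show "refl_on (bracket_pairs A r) (bracket_pair_iso A r)"
    using assms by (auto simp: refl_on_def bracket_pair_iso_def bracket_pairs_def
        factorization_bracket_pair_def intro: isomorphic_brackets_refl)
  show "sym (bracket_pair_iso A r)"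
    by (auto simp: sym_def bracket_pair_iso_def intro: isomorphic_brackets_sym)
  show "trans (bracket_pair_iso A r)"
    using assms unfolding preorder_on_def
    by (intro transI) (auto simp: bracket_pair_iso_def intro: isomorphic_brackets_trans)
qed

subsection \<open>Factorization systems\<close>

text \<open>
  \<open>has_lift r f g\<close>: every square from \<open>f\<close> to \<open>g\<close> has a diagonal filler.
\<close>

definition has_lift :: "'a rel \<Rightarrow> 'a \<times> 'a \<Rightarrow> 'a \<times> 'a \<Rightarrow> bool" where
  "has_lift r f g \<longleftrightarrow>
     ((fst f, fst g) \<in> r \<longrightarrow> (snd f, snd g) \<in> r \<longrightarrow> (snd f, fst g) \<in> r)"

definition left_lifting :: "'a rel \<Rightarrow> 'a rel \<Rightarrow> 'a rel" where
  "left_lifting r R = {f \<in> r. \<forall>g \<in> R. has_lift r f g}"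

definition right_lifting :: "'a rel \<Rightarrow> 'a rel \<Rightarrow> 'a rel" where
  "right_lifting r L = {g \<in> r. \<forall>f \<in> L. has_lift r f g}"

definition factorization_system :: "'a rel \<Rightarrow> 'a rel \<Rightarrow> 'a rel \<Rightarrow> bool" where
  "factorization_system r L R \<longleftrightarrow>
     (\<forall>X Y. (X, Y) \<in> r \<longrightarrow> (\<exists>W. (X, W) \<in> L \<and> (W, Y) \<in> R)) \<and>
     L = left_lifting r R \<and>
     R = right_lifting r L"

definition factorization_systems :: "'a rel \<Rightarrow> ('a rel \<times> 'a rel) set" where
  "factorization_systems r = {(L, R). factorization_system r L R}"

subsection \<open>Model structures\<close>

definition wide_subcategory :: "'a set \<Rightarrow> 'a rel \<Rightarrow> 'a rel \<Rightarrow> bool" where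
  "wide_subcategory A r C \<longleftrightarrow> C \<subseteq> r \<and> Id_on A \<subseteq> C \<and> trans C"

definition retract_of_morphism :: "'a rel \<Rightarrow> 'a \<times> 'a \<Rightarrow> 'a \<times> 'a \<Rightarrow> bool" where
  "retract_of_morphism r g f \<longleftrightarrow> f \<in> r \<and> g \<in> r \<and>
     (fst g, fst f) \<in> r \<and> (fst f, fst g) \<in> r \<and> (snd g, snd f) \<in> r \<and> (snd f, snd g) \<in> r"

definition retract_closed :: "'a rel \<Rightarrow> 'a rel \<Rightarrow> bool" where
  "retract_closed r C \<longleftrightarrow> (\<forall>f g. f \<in> C \<longrightarrow> retract_of_morphism r g f \<longrightarrow> g \<in> C)"

definition two_out_of_three :: "'a rel \<Rightarrow> 'a rel \<Rightarrow> bool" where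
  "two_out_of_three r C \<longleftrightarrow> (\<forall>X Y Z. (X, Y) \<in> r \<longrightarrow> (Y, Z) \<in> r \<longrightarrow>
     ((X, Y) \<in> C \<and> (Y, Z) \<in> C \<longrightarrow> (X, Z) \<in> C) \<and>
     ((X, Y) \<in> C \<and> (X, Z) \<in> C \<longrightarrow> (Y, Z) \<in> C) \<and>
     ((Y, Z) \<in> C \<and> (X, Z) \<in> C \<longrightarrow> (X, Y) \<in> C))"

definition model_structure :: "'a set \<Rightarrow> 'a rel \<Rightarrow> 'a rel \<Rightarrow> 'a rel \<Rightarrow> 'a rel \<Rightarrow> bool" where
  "model_structure A r cof we fib \<longleftrightarrow>
     (\<forall>C \<in> {cof, we, fib}. wide_subcategory A r C \<and> retract_closed r C) \<and>
     factorization_system r (cof \<inter> we) fib \<and>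
     factorization_system r cof (we \<inter> fib) \<and>
     two_out_of_three r we"

definition model_structures :: "'a set \<Rightarrow> 'a rel \<Rightarrow> ('a rel \<times> 'a rel \<times> 'a rel) set" where
  "model_structures A r = {(cof, we, fib). model_structure A r cof we fib}"

subsection \<open>The correspondences\<close>

definition bracket_of_system :: "'a rel \<Rightarrow> ('a \<times> 'a \<Rightarrow> 'a) \<Rightarrow> 'a rel \<times> 'a rel \<Rightarrow> bool" where
  "bracket_of_system r \<Phi> = (\<lambda>(L, R).
     \<forall>X Y. (X, Y) \<in> r \<longrightarrow> (X, \<Phi> (X, Y)) \<in> L \<and> (\<Phi> (X, Y), Y) \<in> R)"

definition bracket_pair_of_model ::
    "'a rel \<Rightarrow> ('a \<times> 'a \<Rightarrow> 'a) \<times> ('a \<times> 'a \<Rightarrow> 'a) \<Rightarrow> 'a rel \<times> 'a rel \<times> 'a rel \<Rightarrow> bool" where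
  "bracket_pair_of_model r = (\<lambda>(\<Phi>, \<Psi>) (cof, we, fib).
     bracket_of_system r \<Phi> (cof \<inter> we, fib) \<and> bracket_of_system r \<Psi> (cof, we \<inter> fib))"

end

theory Submission
  imports Defs
begin

(* In a preorder the lifting properties alone determine a factorization up to isomorphism, so a
   bracket Phi is recovered from L = {Phi(X,Y) iso Y} and R = {Phi(X,Y) iso X}. For a bracket pair
   the weak equivalences are the relations with Phi(X,Y) iso Psi(X,Y), equivalently the composites
   of an acyclic cofibration with an acyclic fibration. Condition (g) makes them closed under
   composition. Conditions (h) and (i) give the two cancellation halves of two-out-of-three, using
   that in a preorder every left class contains (P,Y) as soon as it contains (X,Y), X \<le> P \<le> Y. *)

section \<open>Isomorphism of objects and maps out of a quotient set\<close>

lemma iso_in_sym: "iso_in r X Y \<Longrightarrow> iso_in r Y X"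
  by (auto simp: iso_in_def)

text \<open>\<open>E\<close> is exactly the kernel of \<open>H\<close> on \<open>B\<close>, so
  \<open>H\<close> descends to an injective map on classes. The second conjunct fixes the value at
  every representative; the stated correspondences are read off from it.\<close>

lemma bij_betw_quotient_fun:
  assumes E: "equiv B E" and surj: "H ` B = M"
    and H: "\<And>b b'. b \<in> B \<Longrightarrow> b' \<in> B \<Longrightarrow> (b, b') \<in> E \<longleftrightarrow> H b = H b'"
  shows "\<exists>F. bij_betw F (B // E) M \<and> (\<forall>c \<in> B // E. \<forall>b \<in> c. F c = H b)"
proof -
  \<comment> \<open>The choice of representative is harmless, because \<open>H\<close> is constant
    on each class.\<close>
  define F where "F c = H (SOME b. b \<in> c)" for c
  have F: "F c = H b" if c: "c \<in> B // E" and b: "b \<in> c" for c b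
  proof -
    have "(SOME b. b \<in> c) \<in> c" using b by (rule someI)
    then have "((SOME b. b \<in> c), b) \<in> E" using quotient_eq_iff[OF E c c] b by blast
    moreover have "c \<subseteq> B" using c E by (meson in_quotient_imp_subset)
    ultimately show ?thesis unfolding F_def using H b \<open>(SOME b. b \<in> c) \<in> c\<close> by blast
  qed
  have Fc: "F (E `` {b}) = H b" if "b \<in> B" for b
    using F quotientI[OF that] equiv_class_self[OF E that] by blast
  have "inj_on F (B // E)"
  proof (rule inj_onI)
    fix c d assume c: "c \<in> B // E" and d: "d \<in> B // E" and eq: "F c = F d"
    from c obtain b where b: "b \<in> B" "c = E `` {b}" by (rule quotientE)
    from d obtain b' where b': "b' \<in> B" "d = E `` {b'}" by (rule quotientE)
    have "(b, b') \<in> E" using eq Fc H b b' by simp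
    then show "c = d" using b b' equiv_class_eq[OF E] by simp
  qed
  moreover have "F ` (B // E) = M"
  proof -
    have "F ` (B // E) = H ` B"
      unfolding quotient_def using Fc by (auto simp: image_iff)
    then show ?thesis using surj by simp
  qed
  ultimately show ?thesis using F unfolding bij_betw_def by blast
qed


subsection \<open>Factorization systems on a preorder\<close>

locale preorder_category =
  fixes A :: "'a set" and r :: "'a rel"
  assumes preorder: "preorder_on A r"
begin

lemma trans: "(X, Y) \<in> r \<Longrightarrow> (Y, Z) \<in> r \<Longrightarrow> (X, Z) \<in> r"
  using preorder unfolding preorder_on_def by (meson transD)

lemma dom_refl: "(X, Y) \<in> r \<Longrightarrow> (X, X) \<in> r"
  and cod_refl: "(X, Y) \<in> r \<Longrightarrow> (Y, Y) \<in> r"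
  and in_carrier: "(X, Y) \<in> r \<Longrightarrow> X \<in> A \<and> Y \<in> A"
  and carrier_refl: "X \<in> A \<Longrightarrow> (X, X) \<in> r"
  using preorder unfolding preorder_on_def refl_on_def by blast+

end

locale factorization = preorder_category A r for A :: "'a set" and r +
  fixes L R :: "'a rel"
  assumes fs: "factorization_system r L R"
begin

lemma leftD: "(X, Y) \<in> L \<Longrightarrow> (X, Y) \<in> r"
  and rightD: "(X, Y) \<in> R \<Longrightarrow> (X, Y) \<in> r"
  using fs unfolding factorization_system_def left_lifting_def right_lifting_def by blast+

lemma factor: "(X, Y) \<in> r \<Longrightarrow> \<exists>W. (X, W) \<in> L \<and> (W, Y) \<in> R"
  using fs unfolding factorization_system_def by blast

lemma lift: "(W, X) \<in> L \<Longrightarrow> (Y, Z) \<in> R \<Longrightarrow> (W, Y) \<in> r \<Longrightarrow> (X, Z) \<in> r \<Longrightarrow> (X, Y) \<in> r"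
  using fs unfolding factorization_system_def left_lifting_def has_lift_def
  by (metis (mono_tags, lifting) fst_conv mem_Collect_eq snd_conv)

text \<open>\<open>L\<close> equals the whole left lifting class, so membership only requires
  fillers against \<open>R\<close>; in a preorder a filler is the single relation \<open>Y\<close>
  \<le> \<open>U\<close>.\<close>

lemma leftI:
  assumes "(X, Y) \<in> r"
    and "\<And>U V. (U, V) \<in> R \<Longrightarrow> (X, U) \<in> r \<Longrightarrow> (Y, V) \<in> r \<Longrightarrow> (Y, U) \<in> r"
  shows "(X, Y) \<in> L"
proof -
  have "(X, Y) \<in> left_lifting r R"
    using assms unfolding left_lifting_def has_lift_def by auto
  then show ?thesis using fs unfolding factorization_system_def by blast
qed

lemma rightI:
  assumes "(X, Y) \<in> r"
    and "\<And>U V. (U, V) \<in> L \<Longrightarrow> (U, X) \<in> r \<Longrightarrow> (V, Y) \<in> r \<Longrightarrow> (V, X) \<in> r"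
  shows "(X, Y) \<in> R"
proof -
  have "(X, Y) \<in> right_lifting r L"
    using assms unfolding right_lifting_def has_lift_def by auto
  then show ?thesis using fs unfolding factorization_system_def by blast
qed

lemma left_id: "X \<in> A \<Longrightarrow> (X, X) \<in> L"
  by (rule leftI) (auto intro: carrier_refl)

lemma right_id: "X \<in> A \<Longrightarrow> (X, X) \<in> R"
  by (rule rightI) (auto intro: carrier_refl)

lemma left_comp:
  assumes "(X, Y) \<in> L" "(Y, Z) \<in> L" shows "(X, Z) \<in> L"
  using assms by (intro leftI) (meson leftD trans lift)+

lemma right_comp:
  assumes "(X, Y) \<in> R" "(Y, Z) \<in> R" shows "(X, Z) \<in> R"
  using assms by (intro rightI) (meson rightD trans lift)+

text \<open>A square out of \<open>Y -> Z\<close> precomposes with \<open>X -> Y\<close> to a square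
  out of \<open>X -> Z\<close>. Its filler starts at \<open>Z\<close>, so it also fills the original
  square, all triangles commuting automatically.\<close>

lemma left_cancel:
  assumes "(X, Z) \<in> L" "(X, Y) \<in> r" "(Y, Z) \<in> r" shows "(Y, Z) \<in> L"
  using assms by (intro leftI) (meson trans lift)+

lemma right_cancel:
  assumes "(X, Z) \<in> R" "(X, Y) \<in> r" "(Y, Z) \<in> r" shows "(X, Y) \<in> R"
  using assms by (intro rightI) (meson trans lift)+

text \<open>A retract of a morphism in a preorder has endpoints isomorphic to those of the morphism,
  so this and its dual also supply retract closure.\<close>

lemma left_iso:
  assumes "(X, Y) \<in> L" "iso_in r X X'" "iso_in r Y Y'" shows "(X', Y') \<in> L"
  using assms unfolding iso_in_def by (intro leftI) (meson trans lift leftD)+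

lemma right_iso:
  assumes "(X, Y) \<in> R" "iso_in r X X'" "iso_in r Y Y'" shows "(X', Y') \<in> R"
  using assms unfolding iso_in_def by (intro rightI) (meson trans lift rightD)+

text \<open>Lifting \<open>X -> W\<close> against \<open>W' -> Y\<close> gives \<open>W\<close>
  \<le> \<open>W'\<close>; exchanging the two factorizations gives the reverse.\<close>

lemma factor_unique:
  assumes "(X, W) \<in> L" "(W, Y) \<in> R" "(X, W') \<in> L" "(W', Y) \<in> R"
  shows "iso_in r W W'"
  using assms unfolding iso_in_def by (meson lift leftD rightD)

lemma bracket_exists: "\<exists>\<Phi>. \<Phi> \<in> r \<rightarrow>\<^sub>E A \<and> bracket_of_system r \<Phi> (L, R)"
proof -
  \<comment> \<open>A middle object is chosen for each relation; restricting to \<open>r\<close>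
    makes the function extensional, as membership in \<open>brackets A r\<close> demands.\<close>
  define \<Phi> where "\<Phi> = restrict (\<lambda>(X, Y). SOME W. (X, W) \<in> L \<and> (W, Y) \<in> R) r"
  have \<Phi>: "(X, \<Phi> (X, Y)) \<in> L \<and> (\<Phi> (X, Y), Y) \<in> R" if "(X, Y) \<in> r" for X Y
    using someI_ex[OF factor[OF that]] that by (simp add: \<Phi>_def)
  moreover have "\<Phi> \<in> r \<rightarrow>\<^sub>E A"
  proof (rule PiE_I)
    fix p assume "p \<in> r"
    then show "\<Phi> p \<in> A" using \<Phi> leftD in_carrier by (metis surj_pair)
  qed (simp add: \<Phi>_def)
  ultimately show ?thesis unfolding bracket_of_system_def by blast
qed

end


subsection \<open>The classes of a bracket\<close>

definition left_class :: "'a rel \<Rightarrow> ('a \<times> 'a \<Rightarrow> 'a) \<Rightarrow> 'a rel" where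
  "left_class r \<Phi> = {(X, Y) \<in> r. iso_in r (\<Phi> (X, Y)) Y}"

definition right_class :: "'a rel \<Rightarrow> ('a \<times> 'a \<Rightarrow> 'a) \<Rightarrow> 'a rel" where
  "right_class r \<Phi> = {(X, Y) \<in> r. iso_in r (\<Phi> (X, Y)) X}"

definition weak_class :: "'a rel \<Rightarrow> ('a \<times> 'a \<Rightarrow> 'a) \<Rightarrow> ('a \<times> 'a \<Rightarrow> 'a) \<Rightarrow> 'a rel" where
  "weak_class r \<Phi> \<Psi> = {(X, Y) \<in> r. iso_in r (\<Phi> (X, Y)) (\<Psi> (X, Y))}"

section \<open>From factorization systems to brackets\<close>

context factorization
begin

context
  fixes \<Phi>
  assumes \<Phi>: "bracket_of_system r \<Phi> (L, R)"
begin

lemma bracket_left: "(X, Y) \<in> r \<Longrightarrow> (X, \<Phi> (X, Y)) \<in> L"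
  and bracket_right: "(X, Y) \<in> r \<Longrightarrow> (\<Phi> (X, Y), Y) \<in> R"
  using \<Phi> unfolding bracket_of_system_def by auto

text \<open>Computes a bracket value up to isomorphism: exhibiting one factorization through
  \<open>W\<close> is enough.\<close>

lemma bracket_unique: "(X, W) \<in> L \<Longrightarrow> (W, Y) \<in> R \<Longrightarrow> iso_in r (\<Phi> (X, Y)) W"
  using factor_unique[OF bracket_left bracket_right] trans[OF leftD rightD] by blast

text \<open>If the bracket is isomorphic to \<open>Y\<close>, then \<open>X -> Y\<close> is
  isomorphic to its left half. Conversely, for \<open>X -> Y\<close> in \<open>L\<close>, the
  factorization ending with the identity of \<open>Y\<close> forces the bracket to be
  \<open>Y\<close> up to isomorphism.\<close>

lemma left_class_eq: "left_class r \<Phi> = L"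
proof (intro equalityI subrelI)
  fix X Y assume "(X, Y) \<in> left_class r \<Phi>"
  then have XY: "(X, Y) \<in> r" "iso_in r (\<Phi> (X, Y)) Y" by (auto simp: left_class_def)
  moreover have "iso_in r X X" using dom_refl[OF XY(1)] by (simp add: iso_in_def)
  ultimately show "(X, Y) \<in> L" using left_iso bracket_left by blast
next
  fix X Y assume XY: "(X, Y) \<in> L"
  then have "(Y, Y) \<in> R" using leftD in_carrier right_id by blast
  then show "(X, Y) \<in> left_class r \<Phi>"
    using bracket_unique[OF XY] leftD[OF XY] by (simp add: left_class_def)
qed

lemma right_class_eq: "right_class r \<Phi> = R"
proof (intro equalityI subrelI)
  fix X Y assume "(X, Y) \<in> right_class r \<Phi>"
  then have XY: "(X, Y) \<in> r" "iso_in r (\<Phi> (X, Y)) X" by (auto simp: right_class_def)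
  moreover have "iso_in r Y Y" using cod_refl[OF XY(1)] by (simp add: iso_in_def)
  ultimately show "(X, Y) \<in> R" using right_iso bracket_right by blast
next
  fix X Y assume XY: "(X, Y) \<in> R"
  then have "(X, X) \<in> L" using rightD in_carrier left_id by blast
  then show "(X, Y) \<in> right_class r \<Phi>"
    using bracket_unique[OF _ XY] rightD[OF XY] by (simp add: right_class_def)
qed

text \<open>For (b), composing \<open>X -> \<Phi> (X, Y)\<close> with the left half of
  \<open>\<Phi> (X, Y) -> Z\<close> stays in \<open>L\<close> and so factors \<open>X -> Z\<close>;
  (c) is dual. Condition (d) is the lifting of a left half against a right half.\<close>

lemma bracket_is_bracket:
  assumes "\<Phi> \<in> r \<rightarrow>\<^sub>E A"
  shows "factorization_bracket A r \<Phi>"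
  unfolding factorization_bracket_def
proof (intro conjI allI impI)
  show "\<Phi> \<in> r \<rightarrow>\<^sub>E A" by fact
  show "(X, \<Phi> (X, Y)) \<in> r" "(\<Phi> (X, Y), Y) \<in> r" if "(X, Y) \<in> r" for X Y
    using bracket_left[OF that] bracket_right[OF that] by (auto intro: leftD rightD)
  show "iso_in r (\<Phi> (\<Phi> (X, Y), Z)) (\<Phi> (X, Z))" if "(X, Y) \<in> r" "(\<Phi> (X, Y), Z) \<in> r" for X Y Z
    using that by (meson iso_in_sym bracket_unique left_comp bracket_left bracket_right)
  show "iso_in r (\<Phi> (X, \<Phi> (Y, Z))) (\<Phi> (X, Z))" if "(Y, Z) \<in> r" "(X, \<Phi> (Y, Z)) \<in> r" for X Y Z
    using that by (meson iso_in_sym bracket_unique right_comp bracket_left bracket_right)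
  show "(\<Phi> (W, X), \<Phi> (Y, Z)) \<in> r"
    if "(W, X) \<in> r" "(Y, Z) \<in> r" "(W, \<Phi> (Y, Z)) \<in> r" "(\<Phi> (W, X), Z) \<in> r" for W X Y Z
    using that by (meson lift bracket_left bracket_right)
qed

end

lemma isomorphic_bracketsI:
  "bracket_of_system r \<Phi> (L, R) \<Longrightarrow> bracket_of_system r \<Phi>' (L, R) \<Longrightarrow> isomorphic_brackets r \<Phi> \<Phi>'"
  unfolding isomorphic_brackets_def by (meson bracket_unique bracket_left bracket_right)

end

section \<open>From brackets to factorization systems\<close>

context preorder_category
begin

context
  fixes \<Phi>
  assumes \<Phi>: "factorization_bracket A r \<Phi>"
begin

lemma bracket_le: "(X, Y) \<in> r \<Longrightarrow> (X, \<Phi> (X, Y)) \<in> r" "(X, Y) \<in> r \<Longrightarrow> (\<Phi> (X, Y), Y) \<in> r"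
  using \<Phi> unfolding factorization_bracket_def by blast+

text \<open>Idempotence: (b) with \<open>Z = Y\<close> puts the second half in the right class, and
  (c) with both sources equal puts the first half in the left class.\<close>

lemma bracket_of_classes: "bracket_of_system r \<Phi> (left_class r \<Phi>, right_class r \<Phi>)"
proof -
  have "iso_in r (\<Phi> (\<Phi> (X, Y), Y)) (\<Phi> (X, Y))" "iso_in r (\<Phi> (X, \<Phi> (X, Y))) (\<Phi> (X, Y))"
    if "(X, Y) \<in> r" for X Y
    using \<Phi> that bracket_le[OF that] unfolding factorization_bracket_def by blast+
  then show ?thesis
    using bracket_le unfolding bracket_of_system_def left_class_def right_class_def by auto
qed

text \<open>Lifting is (d) transported along the isomorphisms \<open>\<Phi> (W, X)\<close> with
  \<open>X\<close> and \<open>\<Phi> (Y, Z)\<close> with \<open>Y\<close>. That the classes contain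
  everything with the lifting property follows by testing a relation against a half of its own
  factorization.\<close>

lemma factorization_system_classes: "factorization_system r (left_class r \<Phi>) (right_class r \<Phi>)"
proof -
  have fl: "(X, \<Phi> (X, Y)) \<in> left_class r \<Phi>" and fr: "(\<Phi> (X, Y), Y) \<in> right_class r \<Phi>"
    if "(X, Y) \<in> r" for X Y
    using bracket_of_classes that unfolding bracket_of_system_def by auto
  have d: "(\<Phi> (W, X), \<Phi> (Y, Z)) \<in> r"
    if "(W, X) \<in> r" "(Y, Z) \<in> r" "(W, \<Phi> (Y, Z)) \<in> r" "(\<Phi> (W, X), Z) \<in> r" for W X Y Z
    using \<Phi> that unfolding factorization_bracket_def by blast
  have lift: "(X, Y) \<in> r"
    if "(W, X) \<in> left_class r \<Phi>" "(Y, Z) \<in> right_class r \<Phi>" "(W, Y) \<in> r" "(X, Z) \<in> r" for W X Y Z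
  proof -
    have 1: "(W, X) \<in> r" "(Y, Z) \<in> r" "(X, \<Phi> (W, X)) \<in> r" "(\<Phi> (Y, Z), Y) \<in> r"
      using that unfolding left_class_def right_class_def iso_in_def by auto
    then have "(\<Phi> (W, X), \<Phi> (Y, Z)) \<in> r"
      using that d bracket_le trans by meson
    then show ?thesis using 1 trans by meson
  qed
  have "left_class r \<Phi> = left_lifting r (right_class r \<Phi>)"
  proof (intro equalityI subrelI)
    fix X Y assume XY: "(X, Y) \<in> left_class r \<Phi>"
    then have "(X, Y) \<in> r" by (simp add: left_class_def)
    then show "(X, Y) \<in> left_lifting r (right_class r \<Phi>)"
      unfolding left_lifting_def has_lift_def by (auto intro: lift[OF XY])
  next
    fix X Y assume *: "(X, Y) \<in> left_lifting r (right_class r \<Phi>)"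
    then have XY: "(X, Y) \<in> r" by (simp add: left_lifting_def)
    \<comment> \<open>The square has the left half \<open>X -> \<Phi> (X, Y)\<close> on top and the
      identity of \<open>Y\<close> below; its filler inverts the right half.\<close>
    then have "(Y, \<Phi> (X, Y)) \<in> r"
      using * fr[OF XY] bracket_le[OF XY] cod_refl[OF XY]
      unfolding left_lifting_def has_lift_def by force
    then show "(X, Y) \<in> left_class r \<Phi>"
      using XY bracket_le[OF XY] by (simp add: left_class_def iso_in_def)
  qed
  moreover have "right_class r \<Phi> = right_lifting r (left_class r \<Phi>)"
  proof (intro equalityI subrelI)
    fix X Y assume XY: "(X, Y) \<in> right_class r \<Phi>"
    then have "(X, Y) \<in> r" by (simp add: right_class_def)
    then show "(X, Y) \<in> right_lifting r (left_class r \<Phi>)"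
      unfolding right_lifting_def has_lift_def by (auto intro: lift[OF _ XY])
  next
    fix X Y assume *: "(X, Y) \<in> right_lifting r (left_class r \<Phi>)"
    then have XY: "(X, Y) \<in> r" by (simp add: right_lifting_def)
    then have "(\<Phi> (X, Y), X) \<in> r"
      using * fl[OF XY] bracket_le[OF XY] dom_refl[OF XY]
      unfolding right_lifting_def has_lift_def by force
    then show "(X, Y) \<in> right_class r \<Phi>"
      using XY bracket_le[OF XY] by (simp add: right_class_def iso_in_def)
  qed
  ultimately show ?thesis
    using fl fr unfolding factorization_system_def by blast
qed

end

section \<open>Isomorphism classes of brackets and factorization systems\<close>

lemma isomorphic_brackets_classes:
  assumes "isomorphic_brackets r \<Phi> \<Phi>'"
  shows "left_class r \<Phi> = left_class r \<Phi>'" "right_class r \<Phi> = right_class r \<Phi>'"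
  using assms unfolding isomorphic_brackets_def left_class_def right_class_def iso_in_def
  by (auto intro: trans)

lemma isomorphic_brackets_weak_class:
  assumes "isomorphic_brackets r \<Phi> \<Phi>'" "isomorphic_brackets r \<Psi> \<Psi>'"
  shows "weak_class r \<Phi> \<Psi> = weak_class r \<Phi>' \<Psi>'"
proof -
  have "iso_in r (\<Phi> (X, Y)) (\<Psi> (X, Y)) \<longleftrightarrow> iso_in r (\<Phi>' (X, Y)) (\<Psi>' (X, Y))"
    if "(X, Y) \<in> r" for X Y
  proof -
    have "iso_in r (\<Phi> (X, Y)) (\<Phi>' (X, Y))" "iso_in r (\<Psi> (X, Y)) (\<Psi>' (X, Y))"
      using assms that by (auto simp: isomorphic_brackets_def)
    then show ?thesis unfolding iso_in_def using trans by blast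
  qed
  then show ?thesis unfolding weak_class_def by auto
qed

text \<open>This gives injectivity: brackets with the same classes factor every relation in one
  common system, where middle objects are unique up to isomorphism.\<close>

lemma isomorphic_brackets_iff:
  assumes "factorization_bracket A r \<Phi>" "factorization_bracket A r \<Phi>'"
  shows "isomorphic_brackets r \<Phi> \<Phi>' \<longleftrightarrow>
    left_class r \<Phi> = left_class r \<Phi>' \<and> right_class r \<Phi> = right_class r \<Phi>'"
proof -
  interpret factorization A r "left_class r \<Phi>" "right_class r \<Phi>"
    by unfold_locales (rule factorization_system_classes[OF assms(1)])
  show ?thesis
  proof
    assume "isomorphic_brackets r \<Phi> \<Phi>'"
    then show "left_class r \<Phi> = left_class r \<Phi>' \<and> right_class r \<Phi> = right_class r \<Phi>'"
      by (simp add: isomorphic_brackets_classes)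
  next
    assume "left_class r \<Phi> = left_class r \<Phi>' \<and> right_class r \<Phi> = right_class r \<Phi>'"
    then have "bracket_of_system r \<Phi>' (left_class r \<Phi>, right_class r \<Phi>)"
      using bracket_of_classes[OF assms(2)] by simp
    then show "isomorphic_brackets r \<Phi> \<Phi>'"
      by (rule isomorphic_bracketsI[OF bracket_of_classes[OF assms(1)]])
  qed
qed

lemma system_has_bracket:
  assumes "factorization_system r L R"
  obtains \<Phi> where "factorization_bracket A r \<Phi>" "left_class r \<Phi> = L" "right_class r \<Phi> = R"
proof -
  interpret factorization A r L R by unfold_locales fact
  obtain \<Phi> where \<Phi>: "\<Phi> \<in> r \<rightarrow>\<^sub>E A" "bracket_of_system r \<Phi> (L, R)"
    using bracket_exists by blast
  show ?thesis
    by (rule that[OF bracket_is_bracket[OF \<Phi>(2,1)] left_class_eq[OF \<Phi>(2)] right_class_eq[OF \<Phi>(2)]])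
qed

theorem brackets_bij_systems:
  "\<exists>F. bij_betw F (brackets A r // bracket_iso A r) (factorization_systems r) \<and>
     (\<forall>c \<in> brackets A r // bracket_iso A r. \<forall>\<Phi> \<in> c. bracket_of_system r \<Phi> (F c))"
proof -
  let ?H = "\<lambda>\<Phi>. (left_class r \<Phi>, right_class r \<Phi>)"
  have E: "equiv (brackets A r) (bracket_iso A r)" by (rule equiv_bracket_iso[OF preorder])
  have "?H ` brackets A r = factorization_systems r"
  proof (intro equalityI subsetI)
    fix s assume "s \<in> ?H ` brackets A r"
    then show "s \<in> factorization_systems r"
      using factorization_system_classes by (auto simp: factorization_systems_def brackets_def)
  next
    fix s assume "s \<in> factorization_systems r"
    then obtain L R where s: "s = (L, R)" "factorization_system r L R"
      by (auto simp: factorization_systems_def)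
    from s(2) obtain \<Phi> where "factorization_bracket A r \<Phi>" "?H \<Phi> = s"
      by (rule system_has_bracket) (simp add: s(1))
    then show "s \<in> ?H ` brackets A r"
      by (auto simp: brackets_def)
  qed
  moreover have "(\<Phi>, \<Phi>') \<in> bracket_iso A r \<longleftrightarrow> ?H \<Phi> = ?H \<Phi>'"
    if "\<Phi> \<in> brackets A r" "\<Phi>' \<in> brackets A r" for \<Phi> \<Phi>'
    using that isomorphic_brackets_iff by (simp add: bracket_iso_def brackets_def)
  ultimately have "\<exists>F. bij_betw F (brackets A r // bracket_iso A r) (factorization_systems r) \<and>
      (\<forall>c \<in> brackets A r // bracket_iso A r. \<forall>\<Phi> \<in> c. F c = ?H \<Phi>)"
    by (rule bij_betw_quotient_fun[OF E])
  then obtain F where "bij_betw F (brackets A r // bracket_iso A r) (factorization_systems r)"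
    and F: "\<forall>c \<in> brackets A r // bracket_iso A r. \<forall>\<Phi> \<in> c. F c = ?H \<Phi>"
    by blast
  moreover have "bracket_of_system r \<Phi> (F c)" if "c \<in> brackets A r // bracket_iso A r" "\<Phi> \<in> c" for c \<Phi>
  proof -
    have "\<Phi> \<in> brackets A r" by (rule subsetD[OF in_quotient_imp_subset[OF E that(1)] that(2)])
    moreover have "F c = ?H \<Phi>" using F that by blast
    ultimately show ?thesis by (simp add: brackets_def bracket_of_classes)
  qed
  ultimately show ?thesis by (intro exI[of _ F]) auto
qed

end


subsection \<open>Model structures\<close>

text \<open>The two inclusions are (e) and (f) in terms of classes. Conditions (g) to (i) are kept
  out so that the setting is available both for bracket pairs and for the two brackets of a model
  structure.\<close>

locale bracket_pair = preorder_category A r for A :: "'a set" and r +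
  fixes \<Phi> \<Psi>
  assumes \<Phi>: "factorization_bracket A r \<Phi>" and \<Psi>: "factorization_bracket A r \<Psi>"
    and acyclic_left: "left_class r \<Phi> \<subseteq> left_class r \<Psi>"
    and acyclic_right: "right_class r \<Psi> \<subseteq> right_class r \<Phi>"
begin

sublocale \<Phi>: factorization A r "left_class r \<Phi>" "right_class r \<Phi>"
  by unfold_locales (rule factorization_system_classes[OF \<Phi>])

sublocale \<Psi>: factorization A r "left_class r \<Psi>" "right_class r \<Psi>"
  by unfold_locales (rule factorization_system_classes[OF \<Psi>])

lemmas \<Phi>_left = \<Phi>.bracket_left[OF bracket_of_classes[OF \<Phi>]]
lemmas \<Phi>_right = \<Phi>.bracket_right[OF bracket_of_classes[OF \<Phi>]]
lemmas \<Psi>_left = \<Psi>.bracket_left[OF bracket_of_classes[OF \<Psi>]]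
lemmas \<Psi>_right = \<Psi>.bracket_right[OF bracket_of_classes[OF \<Psi>]]
lemmas \<Phi>_unique = \<Phi>.bracket_unique[OF bracket_of_classes[OF \<Phi>]]
lemmas \<Psi>_unique = \<Psi>.bracket_unique[OF bracket_of_classes[OF \<Psi>]]

abbreviation "W \<equiv> weak_class r \<Phi> \<Psi>"

text \<open>By the two inclusions, the single object \<open>V\<close> factors \<open>X -> Y\<close>
  in both systems at once, so both brackets are isomorphic to \<open>V\<close>.\<close>

lemma weakI:
  assumes "(X, V) \<in> left_class r \<Phi>" "(V, Y) \<in> right_class r \<Psi>"
  shows "(X, Y) \<in> W"
proof -
  have "iso_in r (\<Phi> (X, Y)) V" "iso_in r (\<Psi> (X, Y)) V"
    using assms acyclic_left acyclic_right \<Phi>_unique \<Psi>_unique by blast+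
  moreover have "(X, Y) \<in> r" using assms \<Phi>.leftD \<Psi>.rightD trans by blast
  ultimately show ?thesis by (auto simp: weak_class_def iso_in_def intro: trans)
qed

text \<open>Converse of \<open>weakI\<close>: once the two middle objects are isomorphic, each half
  can be moved from one system to the other.\<close>

lemma weakD: assumes "(X, Y) \<in> W"
  shows "(X, Y) \<in> r" "(\<Phi> (X, Y), Y) \<in> right_class r \<Psi>" "(X, \<Psi> (X, Y)) \<in> left_class r \<Phi>"
proof -
  show XY: "(X, Y) \<in> r" using assms by (auto simp: weak_class_def)
  have i: "iso_in r (\<Phi> (X, Y)) (\<Psi> (X, Y))" using assms by (auto simp: weak_class_def)
  have refl: "iso_in r X X" "iso_in r Y Y"
    using XY dom_refl cod_refl by (auto simp: iso_in_def)
  show "(\<Phi> (X, Y), Y) \<in> right_class r \<Psi>"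
    using \<Psi>.right_iso[OF \<Psi>_right[OF XY] iso_in_sym[OF i] refl(2)] .
  show "(X, \<Psi> (X, Y)) \<in> left_class r \<Phi>"
    using \<Phi>.left_iso[OF \<Phi>_left[OF XY] refl(1) i] .
qed

lemma weak_iff_left: "(X, Y) \<in> r \<Longrightarrow> (X, Y) \<in> W \<longleftrightarrow> (X, \<Psi> (X, Y)) \<in> left_class r \<Phi>"
  using weakI weakD(3) \<Psi>_right by blast

lemma weak_iff_right: "(X, Y) \<in> r \<Longrightarrow> (X, Y) \<in> W \<longleftrightarrow> (\<Phi> (X, Y), Y) \<in> right_class r \<Psi>"
  using weakI weakD(2) \<Phi>_left by blast

text \<open>The acyclic classes are thus the intersections with \<open>W\<close> that a model
  structure prescribes. A map in an acyclic class is weak by composing it with an identity in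
  \<open>weakI\<close>.\<close>

lemma left_weak_eq: "left_class r \<Psi> \<inter> W = left_class r \<Phi>"
  and right_weak_eq: "W \<inter> right_class r \<Phi> = right_class r \<Psi>"
proof -
  have "left_class r \<Psi> \<inter> W \<subseteq> left_class r \<Phi>" "W \<inter> right_class r \<Phi> \<subseteq> right_class r \<Psi>"
    unfolding left_class_def right_class_def weak_class_def iso_in_def by (auto intro: trans)
  moreover have "left_class r \<Phi> \<subseteq> W"
    using weakI \<Psi>.right_id \<Phi>.leftD in_carrier by (metis subrelI)
  moreover have "right_class r \<Psi> \<subseteq> W"
    using weakI \<Phi>.left_id \<Psi>.rightD in_carrier by (metis subrelI)
  ultimately show "left_class r \<Psi> \<inter> W = left_class r \<Phi>" "W \<inter> right_class r \<Phi> = right_class r \<Psi>"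
    using acyclic_left acyclic_right by blast+
qed

lemma weak_iso:
  assumes "(X, Y) \<in> W" "iso_in r X X'" "iso_in r Y Y'" shows "(X', Y') \<in> W"
proof -
  have "iso_in r (\<Psi> (X, Y)) (\<Psi> (X, Y))"
    using weakD(3)[OF assms(1)] \<Phi>.leftD cod_refl by (auto simp: iso_in_def)
  then show ?thesis
    using assms weakI \<Phi>.left_iso[OF weakD(3)[OF assms(1)]] \<Psi>.right_iso[OF \<Psi>_right] weakD(1) by blast
qed

text \<open>Part of two-out-of-three that uses no condition (g) to (i): lifting
  \<open>X -> Y\<close> against \<open>\<Phi> (X, Z) -> Z\<close> places \<open>Y\<close> below
  \<open>\<Phi> (X, Z)\<close>. Then \<open>Y -> \<Phi> (X, Z)\<close> is an acyclic cofibration by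
  cancellation, followed by an acyclic fibration.\<close>

lemma weak_left_cancel:
  assumes "(X, Z) \<in> W" "(X, Y) \<in> left_class r \<Phi>" "(Y, Z) \<in> r"
  shows "(Y, Z) \<in> W"
proof -
  have XZ: "(X, Z) \<in> r" using assms weakD by blast
  have "(Y, \<Phi> (X, Z)) \<in> r"
    using \<Phi>.lift[OF assms(2) \<Phi>_right[OF XZ]] \<Phi>_left[OF XZ] \<Phi>.leftD assms(3) by blast
  then have "(Y, \<Phi> (X, Z)) \<in> left_class r \<Phi>"
    using \<Phi>.left_cancel[OF \<Phi>_left[OF XZ]] assms(2) \<Phi>.leftD by blast
  then show ?thesis using weakI weakD(2)[OF assms(1)] by blast
qed

lemma weak_right_cancel:
  assumes "(X, Z) \<in> W" "(Y, Z) \<in> right_class r \<Psi>" "(X, Y) \<in> r"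
  shows "(X, Y) \<in> W"
proof -
  have XZ: "(X, Z) \<in> r" using assms weakD by blast
  have "(\<Psi> (X, Z), Y) \<in> r"
    using \<Psi>.lift[OF \<Psi>_left[OF XZ] assms(2)] \<Psi>_right[OF XZ] \<Psi>.rightD assms(3) by blast
  then have "(\<Psi> (X, Z), Y) \<in> right_class r \<Psi>"
    using \<Psi>.right_cancel[OF \<Psi>_right[OF XZ]] assms(2) \<Psi>.rightD by blast
  then show ?thesis using weakI weakD(3)[OF assms(1)] by blast
qed

text \<open>The hypotheses are (g), (h) and (i) rewritten as class membership; they provide closure
  under composition and the two cancellations of two-out-of-three, respectively.\<close>

lemma model_structure_if:
  assumes g: "\<And>X Y Z. (X, Y) \<in> r \<Longrightarrow> (Y, Z) \<in> r \<Longrightarrow> (\<Psi> (X, Y), \<Phi> (Y, Z)) \<in> W"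
    and h: "\<And>X Y Z. (X, Y) \<in> r \<Longrightarrow> (Y, Z) \<in> r \<Longrightarrow> (\<Psi> (X, Y), \<Psi> (Y, Z)) \<in> W \<Longrightarrow>
        (Y, \<Psi> (Y, Z)) \<in> left_class r \<Phi>"
    and i: "\<And>X Y Z. (X, Y) \<in> r \<Longrightarrow> (Y, Z) \<in> r \<Longrightarrow> (\<Phi> (X, Y), \<Phi> (Y, Z)) \<in> W \<Longrightarrow>
        (\<Phi> (X, Y), Y) \<in> right_class r \<Psi>"
  shows "model_structure A r (left_class r \<Psi>) W (right_class r \<Phi>)"
proof -
  have comp: "(X, Z) \<in> W" if XY: "(X, Y) \<in> W" and YZ: "(Y, Z) \<in> W" for X Y Z
  proof -
    \<comment> \<open>Factor \<open>X -> Z\<close> as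
      \<open>X -> \<Psi> (X, Y) -> \<Phi> (Y, Z) -> Z\<close>: the outer maps are an acyclic
      cofibration and an acyclic fibration, and splitting the weak middle map lets each half be
      absorbed.\<close>
    have "(\<Psi> (X, Y), \<Phi> (Y, Z)) \<in> W" using g weakD(1) that by blast
    then obtain V where V: "(\<Psi> (X, Y), V) \<in> left_class r \<Phi>" "(V, \<Phi> (Y, Z)) \<in> right_class r \<Psi>"
      using weakD \<Psi>_right by blast
    show ?thesis
      using weakI \<Phi>.left_comp[OF weakD(3)[OF XY] V(1)] \<Psi>.right_comp[OF V(2) weakD(2)[OF YZ]] by blast
  qed
  have left: "(Y, Z) \<in> W" if XY: "(X, Y) \<in> W" and XZ: "(X, Z) \<in> W" and r: "(Y, Z) \<in> r" for X Y Z
  proof -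
    have XY': "(X, Y) \<in> r" using XY weakD by blast
    have 1: "(\<Psi> (X, Y), Y) \<in> r" "(Y, \<Psi> (Y, Z)) \<in> r"
      using XY' r \<Psi>_left \<Psi>_right \<Psi>.leftD \<Psi>.rightD by blast+
    \<comment> \<open>Cancelling the acyclic cofibration \<open>X -> \<Psi> (X, Y)\<close> and then
      the acyclic fibration \<open>\<Psi> (Y, Z) -> Z\<close> turns the weak map
      \<open>X -> Z\<close> into the premise of (h).\<close>
    have "(\<Psi> (X, Y), Z) \<in> W" using weak_left_cancel[OF XZ weakD(3)[OF XY]] trans 1 r by blast
    then have "(\<Psi> (X, Y), \<Psi> (Y, Z)) \<in> W" using weak_right_cancel \<Psi>_right[OF r] trans[OF 1] by blast
    then show ?thesis using h XY' r weak_iff_left by blast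
  qed
  have right: "(X, Y) \<in> W" if YZ: "(Y, Z) \<in> W" and XZ: "(X, Z) \<in> W" and r: "(X, Y) \<in> r" for X Y Z
  proof -
    have YZ': "(Y, Z) \<in> r" using YZ weakD by blast
    have 1: "(\<Phi> (X, Y), Y) \<in> r" "(Y, \<Phi> (Y, Z)) \<in> r"
      using YZ' r \<Phi>_left \<Phi>_right \<Phi>.leftD \<Phi>.rightD by blast+
    \<comment> \<open>Dually, \<open>\<Phi> (Y, Z) -> Z\<close> is cancelled first and
      \<open>X -> \<Phi> (X, Y)\<close> second, to reach the premise of (i).\<close>
    have "(X, \<Phi> (Y, Z)) \<in> W" using weak_right_cancel[OF XZ weakD(2)[OF YZ]] trans 1 r by blast
    then have "(\<Phi> (X, Y), \<Phi> (Y, Z)) \<in> W" using weak_left_cancel \<Phi>_left[OF r] trans[OF 1] by blast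
    then show ?thesis using i YZ' r weak_iff_right by blast
  qed
  have "two_out_of_three r W"
    unfolding two_out_of_three_def using comp left right by blast
  moreover have "wide_subcategory A r (left_class r \<Psi>)" "wide_subcategory A r (right_class r \<Phi>)"
    unfolding wide_subcategory_def trans_def
    by (auto intro: \<Psi>.leftD \<Psi>.left_id \<Psi>.left_comp \<Phi>.rightD \<Phi>.right_id \<Phi>.right_comp)
  moreover have "wide_subcategory A r W"
    unfolding wide_subcategory_def trans_def
    by (auto intro: comp weakD(1) weakI[OF \<Phi>.left_id \<Psi>.right_id])
  moreover have "retract_closed r (left_class r \<Psi>)" "retract_closed r (right_class r \<Phi>)"
      "retract_closed r W"
    unfolding retract_closed_def retract_of_morphism_def
    using \<Psi>.left_iso \<Phi>.right_iso weak_iso by (auto simp: iso_in_def)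
  ultimately show ?thesis
    unfolding model_structure_def left_weak_eq right_weak_eq using \<Phi>.fs \<Psi>.fs by blast
qed

text \<open>Each of (g) to (i) is an instance of two-out-of-three for a composite through
  \<open>Y\<close>: (g) composes two weak maps, (h) cancels \<open>\<Psi> (X, Y) -> Y\<close>, and
  (i) cancels \<open>Y -> \<Phi> (Y, Z)\<close>.\<close>

lemma factorization_bracket_pair_if:
  assumes "two_out_of_three r W"
  shows "factorization_bracket_pair A r \<Phi> \<Psi>"
  unfolding factorization_bracket_pair_def
proof (intro conjI allI impI)
  show "factorization_bracket A r \<Phi>" "factorization_bracket A r \<Psi>" by (fact \<Phi> \<Psi>)+
  have iso: "iso_in r (\<Phi> (X, Y)) (\<Psi> (X, Y)) \<longleftrightarrow> (X, Y) \<in> W" if "(X, Y) \<in> r" for X Y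
    using that by (simp add: weak_class_def)
  have left: "(X, Y) \<in> W" if "(X, Y) \<in> left_class r \<Phi>" for X Y
    using that left_weak_eq by blast
  have right: "(X, Y) \<in> W" if "(X, Y) \<in> right_class r \<Psi>" for X Y
    using that right_weak_eq by blast
  note two = assms[unfolded two_out_of_three_def, rule_format]
  show "iso_in r (\<Psi> (X, \<Phi> (X, Y))) (\<Phi> (X, Y))" if "(X, Y) \<in> r" for X Y
    using subsetD[OF acyclic_left \<Phi>_left[OF that]] by (simp add: left_class_def)
  show "iso_in r (\<Phi> (\<Psi> (X, Y), Y)) (\<Psi> (X, Y))" if "(X, Y) \<in> r" for X Y
    using subsetD[OF acyclic_right \<Psi>_right[OF that]] by (simp add: right_class_def)
  fix X Y Z assume XY: "(X, Y) \<in> r" and YZ: "(Y, Z) \<in> r"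
  have p: "(\<Psi> (X, Y), Y) \<in> r" "(Y, \<Phi> (Y, Z)) \<in> r" "(Y, \<Psi> (Y, Z)) \<in> r" "(\<Phi> (X, Y), Y) \<in> r"
    using XY YZ bracket_le \<Phi> \<Psi> by blast+
  note q = trans[OF p(1,2)] trans[OF p(1,3)] trans[OF p(4,2)]
  show "iso_in r (\<Phi> (\<Psi> (X, Y), \<Phi> (Y, Z))) (\<Psi> (\<Psi> (X, Y), \<Phi> (Y, Z)))"
    using iso[OF q(1)] two[OF p(1,2)] left[OF \<Phi>_left[OF YZ]] right[OF \<Psi>_right[OF XY]] by blast
  show "iso_in r (\<Phi> (Y, \<Psi> (Y, Z))) (\<Psi> (Y, Z))"
    if "iso_in r (\<Phi> (\<Psi> (X, Y), \<Psi> (Y, Z))) (\<Psi> (\<Psi> (X, Y), \<Psi> (Y, Z)))"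
  proof -
    have "(Y, \<Psi> (Y, Z)) \<in> W"
      using that iso[OF q(2)] two[OF p(1,3)] right[OF \<Psi>_right[OF XY]] by blast
    then have "(Y, \<Psi> (Y, Z)) \<in> left_class r \<Phi>" using \<Psi>_left[OF YZ] left_weak_eq by blast
    then show ?thesis by (simp add: left_class_def)
  qed
  show "iso_in r (\<Psi> (\<Phi> (X, Y), Y)) (\<Phi> (X, Y))"
    if "iso_in r (\<Phi> (\<Phi> (X, Y), \<Phi> (Y, Z))) (\<Psi> (\<Phi> (X, Y), \<Phi> (Y, Z)))"
  proof -
    have "(\<Phi> (X, Y), Y) \<in> W"
      using that iso[OF q(3)] two[OF p(4,2)] left[OF \<Phi>_left[OF YZ]] by blast
    then have "(\<Phi> (X, Y), Y) \<in> right_class r \<Psi>" using \<Phi>_right[OF XY] right_weak_eq by blast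
    then show ?thesis by (simp add: right_class_def)
  qed
qed

end

section \<open>Isomorphism classes of bracket pairs and model structures\<close>

context preorder_category
begin

text \<open>Condition (e) says that \<open>X -> \<Phi> (X, Y)\<close> is a cofibration; for an
  acyclic cofibration this is \<open>X -> Y\<close> up to isomorphism. Condition (f) handles
  fibrations dually.\<close>

lemma bracket_pair_locale:
  assumes P: "factorization_bracket_pair A r \<Phi> \<Psi>"
  shows "bracket_pair A r \<Phi> \<Psi>"
proof -
  have \<Phi>: "factorization_bracket A r \<Phi>" and \<Psi>: "factorization_bracket A r \<Psi>"
    using P by (auto simp: factorization_bracket_pair_def)
  interpret \<Phi>: factorization A r "left_class r \<Phi>" "right_class r \<Phi>"
    by unfold_locales (rule factorization_system_classes[OF \<Phi>])
  interpret \<Psi>: factorization A r "left_class r \<Psi>" "right_class r \<Psi>"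
    by unfold_locales (rule factorization_system_classes[OF \<Psi>])
  have refl: "iso_in r X X \<and> iso_in r Y Y" if "(X, Y) \<in> r" for X Y
    using dom_refl cod_refl that by (auto simp: iso_in_def)
  show ?thesis
  proof unfold_locales
    show "left_class r \<Phi> \<subseteq> left_class r \<Psi>"
    proof (rule subrelI)
      fix X Y assume "(X, Y) \<in> left_class r \<Phi>"
      then have XY: "(X, Y) \<in> r" and i: "iso_in r (\<Phi> (X, Y)) Y" by (auto simp: left_class_def)
      have "(X, \<Phi> (X, Y)) \<in> left_class r \<Psi>"
        using P XY bracket_le[OF \<Phi> XY] by (simp add: left_class_def factorization_bracket_pair_def)
      then show "(X, Y) \<in> left_class r \<Psi>" using \<Psi>.left_iso i refl XY by blast
    qed
    show "right_class r \<Psi> \<subseteq> right_class r \<Phi>"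
    proof (rule subrelI)
      fix X Y assume "(X, Y) \<in> right_class r \<Psi>"
      then have XY: "(X, Y) \<in> r" and i: "iso_in r (\<Psi> (X, Y)) X" by (auto simp: right_class_def)
      have "(\<Psi> (X, Y), Y) \<in> right_class r \<Phi>"
        using P XY bracket_le[OF \<Psi> XY] by (simp add: right_class_def factorization_bracket_pair_def)
      then show "(X, Y) \<in> right_class r \<Phi>" using \<Phi>.right_iso i refl XY by blast
    qed
  qed (fact \<Phi> \<Psi>)+
qed

lemma model_structure_classes:
  assumes P: "factorization_bracket_pair A r \<Phi> \<Psi>"
  shows "model_structure A r (left_class r \<Psi>) (weak_class r \<Phi> \<Psi>) (right_class r \<Phi>)"
proof -
  interpret bracket_pair A r \<Phi> \<Psi> by (rule bracket_pair_locale[OF P])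
  show ?thesis
  proof (rule model_structure_if)
    fix X Y Z assume XY: "(X, Y) \<in> r" and YZ: "(Y, Z) \<in> r"
    have p: "(\<Psi> (X, Y), Y) \<in> r" "(Y, \<Phi> (Y, Z)) \<in> r" "(Y, \<Psi> (Y, Z)) \<in> r" "(\<Phi> (X, Y), Y) \<in> r"
      using XY YZ bracket_le \<Phi> \<Psi> by blast+
    note q = trans[OF p(1,2)] trans[OF p(1,3)] trans[OF p(4,2)]
    show "(\<Psi> (X, Y), \<Phi> (Y, Z)) \<in> weak_class r \<Phi> \<Psi>"
      using P XY YZ q by (simp add: factorization_bracket_pair_def weak_class_def)
    show "(Y, \<Psi> (Y, Z)) \<in> left_class r \<Phi>" if "(\<Psi> (X, Y), \<Psi> (Y, Z)) \<in> weak_class r \<Phi> \<Psi>"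
      using P XY YZ p that unfolding factorization_bracket_pair_def weak_class_def left_class_def
      by blast
    show "(\<Phi> (X, Y), Y) \<in> right_class r \<Psi>" if "(\<Phi> (X, Y), \<Phi> (Y, Z)) \<in> weak_class r \<Phi> \<Psi>"
      using P XY YZ p that unfolding factorization_bracket_pair_def weak_class_def right_class_def
      by blast
  qed
qed

text \<open>The brackets come from the two factorization systems; what remains is that the given
  \<open>we\<close> agrees with the weak class computed from them.\<close>

lemma model_has_bracket_pair:
  assumes M: "model_structure A r cof we fib"
  obtains \<Phi> \<Psi> where "factorization_bracket_pair A r \<Phi> \<Psi>"
    "left_class r \<Psi> = cof" "weak_class r \<Phi> \<Psi> = we" "right_class r \<Phi> = fib"
proof -
  have "factorization_system r (cof \<inter> we) fib" "factorization_system r cof (we \<inter> fib)"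
    using M by (auto simp: model_structure_def)
  then obtain \<Phi> \<Psi> where P: "factorization_bracket A r \<Phi>" "left_class r \<Phi> = cof \<inter> we" "right_class r \<Phi> = fib"
    and Q: "factorization_bracket A r \<Psi>" "left_class r \<Psi> = cof" "right_class r \<Psi> = we \<inter> fib"
    by (metis system_has_bracket)
  interpret bracket_pair A r \<Phi> \<Psi> using P Q by unfold_locales auto
  have we: "we \<subseteq> r" "trans we" and two: "two_out_of_three r we"
    using M by (auto simp: model_structure_def wide_subcategory_def)
  have "W = we"
  proof (intro equalityI subrelI)
    fix X Y assume "(X, Y) \<in> W"
    then have "(X, \<Psi> (X, Y)) \<in> we" "(\<Psi> (X, Y), Y) \<in> we"
      using weakD(3) \<Psi>_right[OF weakD(1)] unfolding P(2) Q(3) by blast+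
    then show "(X, Y) \<in> we" using we by (meson transD)
  next
    fix X Y assume XY: "(X, Y) \<in> we"
    then have r: "(X, Y) \<in> r" using we by blast
    have "(X, \<Phi> (X, Y)) \<in> we" "(\<Phi> (X, Y), Y) \<in> fib" 
      using \<Phi>_left[OF r] \<Phi>_right[OF r] unfolding P(2,3) by blast+
    \<comment> \<open>Two-out-of-three makes the fibration half of a weak equivalence weak, hence an
      acyclic fibration.\<close>
    then have "(\<Phi> (X, Y), Y) \<in> right_class r \<Psi>"
      using two bracket_le[OF P(1) r] XY Q(3) unfolding two_out_of_three_def by blast
    then show "(X, Y) \<in> W" using weak_iff_right r by blast
  qed
  then show ?thesis using that factorization_bracket_pair_if two P(3) Q(2) by simp
qed

theorem bracket_pairs_bij_models:
  "\<exists>G. bij_betw G (bracket_pairs A r // bracket_pair_iso A r) (model_structures A r) \<and>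
     (\<forall>c \<in> bracket_pairs A r // bracket_pair_iso A r. \<forall>p \<in> c. bracket_pair_of_model r p (G c))"
proof -
  let ?H = "\<lambda>(\<Phi>, \<Psi>). (left_class r \<Psi>, weak_class r \<Phi> \<Psi>, right_class r \<Phi>)"
  have E: "equiv (bracket_pairs A r) (bracket_pair_iso A r)"
    by (rule equiv_bracket_pair_iso[OF preorder])
  have "?H ` bracket_pairs A r = model_structures A r"
  proof (intro equalityI subsetI)
    fix m assume "m \<in> ?H ` bracket_pairs A r"
    then show "m \<in> model_structures A r"
      using model_structure_classes by (auto simp: model_structures_def bracket_pairs_def)
  next
    fix m assume "m \<in> model_structures A r"
    then obtain cof we fib where m: "m = (cof, we, fib)" "model_structure A r cof we fib"
      by (auto simp: model_structures_def)
    from m(2) obtain \<Phi> \<Psi> where "factorization_bracket_pair A r \<Phi> \<Psi>" "?H (\<Phi>, \<Psi>) = m"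
      by (rule model_has_bracket_pair) (simp add: m(1))
    then show "m \<in> ?H ` bracket_pairs A r"
      by (intro image_eqI[where x = "(\<Phi>, \<Psi>)"]) (auto simp: bracket_pairs_def)
  qed
  moreover have "(p, p') \<in> bracket_pair_iso A r \<longleftrightarrow> ?H p = ?H p'"
    if "p \<in> bracket_pairs A r" "p' \<in> bracket_pairs A r" for p p'
  proof -
    obtain \<Phi> \<Psi> \<Phi>' \<Psi>' where p: "p = (\<Phi>, \<Psi>)" "p' = (\<Phi>', \<Psi>')" by (metis surj_pair)
    then have P: "factorization_bracket_pair A r \<Phi> \<Psi>" "factorization_bracket_pair A r \<Phi>' \<Psi>'"
      using that by (auto simp: bracket_pairs_def)
    interpret p: bracket_pair A r \<Phi> \<Psi> by (rule bracket_pair_locale[OF P(1)])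
    interpret p': bracket_pair A r \<Phi>' \<Psi>' by (rule bracket_pair_locale[OF P(2)])
    \<comment> \<open>\<open>?H\<close> records only one class of each bracket; the left class of
      \<open>\<Phi>\<close> and the right class of \<open>\<Psi>\<close> are recovered by
      intersecting with the weak class.\<close>
    have "isomorphic_brackets r \<Phi> \<Phi>' \<and> isomorphic_brackets r \<Psi> \<Psi>' \<longleftrightarrow> ?H (\<Phi>, \<Psi>) = ?H (\<Phi>', \<Psi>')"
      using isomorphic_brackets_iff[OF p.\<Phi> p'.\<Phi>] isomorphic_brackets_iff[OF p.\<Psi> p'.\<Psi>]
        isomorphic_brackets_weak_class p.left_weak_eq p'.left_weak_eq p.right_weak_eq p'.right_weak_eq
      by auto
    then show ?thesis using that p by (simp add: bracket_pair_iso_def)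
  qed
  ultimately have "\<exists>G. bij_betw G (bracket_pairs A r // bracket_pair_iso A r) (model_structures A r) \<and>
      (\<forall>c \<in> bracket_pairs A r // bracket_pair_iso A r. \<forall>p \<in> c. G c = ?H p)"
    by (rule bij_betw_quotient_fun[OF E])
  then obtain G where
    "bij_betw G (bracket_pairs A r // bracket_pair_iso A r) (model_structures A r)"
    and G: "\<forall>c \<in> bracket_pairs A r // bracket_pair_iso A r. \<forall>p \<in> c. G c = ?H p"
    by blast
  moreover have "bracket_pair_of_model r p (G c)"
    if "c \<in> bracket_pairs A r // bracket_pair_iso A r" "p \<in> c" for c p
  proof -
    obtain \<Phi> \<Psi> where p: "p = (\<Phi>, \<Psi>)" by (metis surj_pair)
    have "p \<in> bracket_pairs A r"
      by (rule subsetD[OF in_quotient_imp_subset[OF E that(1)] that(2)])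
    then interpret bracket_pair A r \<Phi> \<Psi>
      using bracket_pair_locale p by (simp add: bracket_pairs_def)
    have "G c = ?H p" using G that by blast
    then show ?thesis
      using bracket_of_classes[OF \<Phi>] bracket_of_classes[OF \<Psi>]
      by (simp add: p bracket_pair_of_model_def left_weak_eq right_weak_eq)
  qed
  ultimately show ?thesis by (intro exI[of _ G]) auto
qed

end

theorem proposition5p3:
  fixes A :: "'a set" and r :: "'a rel"
  assumes "preorder_on A r"
  shows
    "(\<exists>F. bij_betw F (brackets A r // bracket_iso A r) (factorization_systems r) \<and>
          (\<forall>c \<in> brackets A r // bracket_iso A r. \<forall>\<Phi> \<in> c. bracket_of_system r \<Phi> (F c))) \<and>
     (\<exists>G. bij_betw G (bracket_pairs A r // bracket_pair_iso A r) (model_structures A r) \<and>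
          (\<forall>c \<in> bracket_pairs A r // bracket_pair_iso A r. \<forall>p \<in> c. bracket_pair_of_model r p (G c)))"
proof -
  interpret preorder_category A r by unfold_locales fact
  show ?thesis using brackets_bij_systems bracket_pairs_bij_models by (rule conjI)
qed

end
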